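(* Assume $\operatorname{Ker}\Phi\cap\operatorname{Ker}D^*=\{0\}$. Let $\lambda>0$ and $y\in\mathbb{R}^Q$ be such that $(y,\lambda)\notin\mathcal{H}$, and let $x^\star$ be a solution of $(\mathcal{P}_\lambda(y))$. Let $I$ and $J$ be the $D$-support and the $D$-cosupport of $x^\star$, and let $s=\operatorname{sign}(D^*x^\star)$. Suppose that $(H_J)$ holds, i.e. $\operatorname{Ker}\Phi\cap\mathcal{G}_J=\{0\}$. For any $\bar y\in\mathbb{R}^Q$ and $\bar\lambda\in\mathbb{R}_+$ define $$\hat x_{\bar\lambda}(\bar y)=A^{[J]}\Phi^*\bar y-\bar\lambda A^{[J]}D_Is_I .$$ Then there exists an open neighborhood $\mathcal{B}\subset\mathbb{R}^Q\times\mathbb{R}_+$ of $(y,\lambda)$ such that for every $(\bar y,\bar\lambda)\in\mathcal{B}$, the vector $\hat x_{\bar\lambda}(\bar y)$ is a solution of $(\mathcal{P}_{\bar\lambda}(\bar y))$.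
   Context: $\Phi:\mathbb{R}^N\to\mathbb{R}^Q$ is a linear operator (a $Q\times N$ real matrix) and $D=(d_i)_{i=1}^P$ is a dictionary of $P$ atoms $d_i\in\mathbb{R}^N$, identified with the $N\times P$ matrix with columns $d_i$. $M^*$ is the adjoint (transpose) of $M$, $\operatorname{Id}$ the identity. For $y\in\mathbb{R}^Q$ and $\lambda>0$, $(\mathcal{P}_\lambda(y))$ is the problem of minimizing over $x\in\mathbb{R}^N$ the function $\frac12\|y-\Phi x\|_2^2+\lambda\|D^*x\|_1$; a solution is a global minimizer. $\mathbb{R}_+=[0,\infty)$. For $J\subset\{1,\dots,P\}$, $J^c$ is its complement, $D_J$ the submatrix of $D$ with columns indexed by $J$, and $s_J$ the restriction of a vector $s$ to the entries indexed by $J$ (with $\operatorname{Im}D_\emptyset=\{0\}$). The sign vector $\operatorname{sign}(\alpha)$ has entries $+1,0,-1$ according to whether $\alpha_i>0$, $\alpha_i=0$, $\alpha_i<0$. The $D$-support of $x$ is $I=\{i:(D^*x)_i\neq0\}$ and its $D$-cosupport is $J=I^c$. The cospace is $\mathcal{G}_J=\operatorname{Ker}D_J^*$ (equal to $\mathbb{R}^N$ if $J=\emptyset$). Condition $(H_J)$: $\operatorname{Ker}\Phi\cap\mathcal{G}_J=\{0\}$. When $(H_J)$ holds, $A^{[J]}=U_J(U_J^*\Phi^*\Phi U_J)^{-1}U_J^*$, where $U_J$ is a matrix whose columns form a basis of $\mathcal{G}_J$ (and $A^{[J]}=0$ if $\mathcal{G}_J=\{0\}$). Set $\tilde\Pi^{[J]}=\Phi^*(\Phi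 A^{[J]}\Phi^*-\operatorname{Id})$ and $\tilde\Omega^{[J]}=(\Phi^*\Phi A^{[J]}-\operatorname{Id})D_{J^c}$. $\operatorname{P}_{\mathcal{G}}$ denotes the orthogonal projector on a subspace $\mathcal{G}$. The transition space is $$\mathcal{H}=\bigcup_{J\subset\{1,\dots,P\},\,(H_J)\text{ holds}}\ \bigcup_{K\subset J,\ \operatorname{Im}\tilde\Pi^{[J]}\not\subseteq\operatorname{Im}D_{J\setminus K}}\ \bigcup_{s_{J^c}\in\{-1,1\}^{|J^c|}}\ \bigcup_{\sigma_K\in\{-1,1\}^{|K|}}\mathcal{H}_{J,K,s_{J^c},\sigma_K},$$ $$\mathcal{H}_{J,K,s_{J^c},\sigma_K}=\{(y,\lambda)\in\mathbb{R}^Q\times\mathbb{R}_+:\ \operatorname{P}_{\mathcal{G}_{J\setminus K}}\tilde\Pi^{[J]}y=\lambda\operatorname{P}_{\mathcal{G}_{J\setminus K}}(\tilde\Omega^{[J]}s_{J^c}-D_K\sigma_K)\}.$$ *)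

theory Defs
  imports "HOL-Analysis.Analysis"
begin

text \<open>
  Submatrices and subvectors keep the index type of the full object: columns (entries) outside
  the index set are replaced by zero. Kernels of \<open>D\<^sub>J\<^sup>*\<close>, images of \<open>D\<^sub>J\<close> and products \<open>D\<^sub>J v\<^sub>J\<close> are
  the same as for the matrix with the columns removed.
\<close>

definition cols :: "real^'p^'n \<Rightarrow> 'p set \<Rightarrow> real^'p^'n" where
  "cols M J = (\<chi> i j. if j \<in> J then M $ i $ j else 0)"

definition entries :: "real^'p \<Rightarrow> 'p set \<Rightarrow> real^'p" where
  "entries v J = (\<chi> i. if i \<in> J then v $ i else 0)"

definition null_space :: "real^'n^'m \<Rightarrow> (real^'n) set" where
  "null_space M = {x. M *v x = 0}"

definition image_space :: "real^'n^'m \<Rightarrow> (real^'m) set" where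
  "image_space M = range ((*v) M)"

definition sign_vec :: "real^'p \<Rightarrow> real^'p" where
  "sign_vec v = (\<chi> i. sgn (v $ i))"

definition sign_patterns :: "'p set \<Rightarrow> (real^'p) set" where
  "sign_patterns J = {s. (\<forall>i\<in>J. s $ i \<in> {-1, 1}) \<and> (\<forall>i\<in>-J. s $ i = 0)}"

definition l1_norm :: "real^'p \<Rightarrow> real" where
  "l1_norm v = (\<Sum>i\<in>UNIV. \<bar>v $ i\<bar>)"

definition objective :: "real^'n^'q \<Rightarrow> real^'p^'n \<Rightarrow> real^'q \<Rightarrow> real \<Rightarrow> real^'n \<Rightarrow> real" where
  "objective \<Phi> D y l x = 1/2 * (norm (y - \<Phi> *v x))\<^sup>2 + l * l1_norm (transpose D *v x)"

definition is_solution :: "real^'n^'q \<Rightarrow> real^'p^'n \<Rightarrow> real^'q \<Rightarrow> real \<Rightarrow> real^'n \<Rightarrow> bool" where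
  "is_solution \<Phi> D y l x \<longleftrightarrow> (\<forall>z. objective \<Phi> D y l x \<le> objective \<Phi> D y l z)"

definition D_support :: "real^'p^'n \<Rightarrow> real^'n \<Rightarrow> 'p set" where
  "D_support D x = {i. (transpose D *v x) $ i \<noteq> 0}"

definition D_cosupport :: "real^'p^'n \<Rightarrow> real^'n \<Rightarrow> 'p set" where
  "D_cosupport D x = - D_support D x"

definition cospace :: "real^'p^'n \<Rightarrow> 'p set \<Rightarrow> (real^'n) set" where
  "cospace D J = null_space (transpose (cols D J))"

definition cond_H :: "real^'n^'q \<Rightarrow> real^'p^'n \<Rightarrow> 'p set \<Rightarrow> bool" where
  "cond_H \<Phi> D J \<longleftrightarrow> null_space \<Phi> \<inter> cospace D J = {0}"

definition orth_proj :: "(real^'n) set \<Rightarrow> real^'n \<Rightarrow> real^'n" where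
  "orth_proj G x = (THE p. p \<in> G \<and> (\<forall>g\<in>G. orthogonal (x - p) g))"

text \<open>
  A matrix whose columns form a basis of \<open>G\<close> has \<open>dim G \<le> N\<close> columns. It is padded with zero
  columns to an \<open>N \<times> N\<close> matrix, so that the basis consists of its nonzero columns, which are
  required to be pairwise distinct.
\<close>

definition col_support :: "real^'p^'n \<Rightarrow> 'p set" where
  "col_support U = {k. column k U \<noteq> 0}"

definition is_basis_matrix :: "real^'n^'n \<Rightarrow> (real^'n) set \<Rightarrow> bool" where
  "is_basis_matrix U G \<longleftrightarrow>
     inj_on (\<lambda>k. column k U) (col_support U) \<and>
     independent ((\<lambda>k. column k U) ` col_support U) \<and>
     span ((\<lambda>k. column k U) ` col_support U) = G"

definition basis_matrix :: "(real^'n) set \<Rightarrow> real^'n^'n" where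
  "basis_matrix G = (SOME U. is_basis_matrix U G)"

text \<open>
  Inverse of a padded square matrix whose rows and columns are indexed by \<open>S\<close>;
  \<open>cols (mat 1) S\<close> is the padded identity. For \<open>S = UNIV\<close> this is \<^const>\<open>matrix_inv\<close>.
\<close>

definition block_inv :: "'n set \<Rightarrow> real^'n^'n \<Rightarrow> real^'n^'n" where
  "block_inv S M = (SOME W. (\<forall>i j. i \<notin> S \<or> j \<notin> S \<longrightarrow> W $ i $ j = 0) \<and>
     M ** W = cols (mat 1) S \<and> W ** M = cols (mat 1) S)"

text \<open>
  Meaningful under \<^const>\<open>cond_H\<close>, and then independent of the basis chosen by
  \<^const>\<open>basis_matrix\<close>. For \<open>cospace D J = {0}\<close> the basis matrix is \<open>0\<close>, hence so is the result.
\<close>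

definition A_op :: "real^'n^'q \<Rightarrow> real^'p^'n \<Rightarrow> 'p set \<Rightarrow> real^'n^'n" where
  "A_op \<Phi> D J =
     (let U = basis_matrix (cospace D J)
      in U ** block_inv (col_support U) (transpose U ** transpose \<Phi> ** \<Phi> ** U) ** transpose U)"

definition Pi_tilde :: "real^'n^'q \<Rightarrow> real^'p^'n \<Rightarrow> 'p set \<Rightarrow> real^'q^'n" where
  "Pi_tilde \<Phi> D J = transpose \<Phi> ** (\<Phi> ** A_op \<Phi> D J ** transpose \<Phi> - mat 1)"

definition Omega_tilde :: "real^'n^'q \<Rightarrow> real^'p^'n \<Rightarrow> 'p set \<Rightarrow> real^'p^'n" where
  "Omega_tilde \<Phi> D J = (transpose \<Phi> ** \<Phi> ** A_op \<Phi> D J - mat 1) ** cols D (-J)"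

definition transition_part ::
  "real^'n^'q \<Rightarrow> real^'p^'n \<Rightarrow> 'p set \<Rightarrow> 'p set \<Rightarrow> real^'p \<Rightarrow> real^'p \<Rightarrow> ((real^'q) \<times> real) set" where
  "transition_part \<Phi> D J K s \<sigma> =
     {(y, l). l \<ge> 0 \<and>
        orth_proj (cospace D (J - K)) (Pi_tilde \<Phi> D J *v y) =
        l *\<^sub>R orth_proj (cospace D (J - K)) (Omega_tilde \<Phi> D J *v s - cols D K *v \<sigma>)}"

definition transition_space :: "real^'n^'q \<Rightarrow> real^'p^'n \<Rightarrow> ((real^'q) \<times> real) set" where
  "transition_space \<Phi> D =
     (\<Union>J\<in>{J. cond_H \<Phi> D J}.
      \<Union>K\<in>{K. K \<subseteq> J \<and> \<not> image_space (Pi_tilde \<Phi> D J) \<subseteq> image_space (cols D (J - K))}.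
      \<Union>s\<in>sign_patterns (-J).
      \<Union>\<sigma>\<in>sign_patterns K. transition_part \<Phi> D J K s \<sigma>)"

end

theory Submission
  imports Defs
begin

text \<open>
  The problem is convex, so \<open>x\<close> solves it for \<open>(y, l)\<close> exactly when there is a dual certificate: a
  subgradient \<open>\<sigma>\<close> of the \<open>\<ell>\<^sup>1\<close> norm at \<open>D\<^sup>*x\<close> with \<open>\<Phi>\<^sup>*(y - \<Phi>x) = l D\<sigma>\<close>
  (lemma \<open>is_solution_iff_certificate\<close>). Such a \<open>\<sigma>\<close> equals the sign \<open>s\<close> off the cosupport \<open>J\<close> and
  ranges over \<open>[-1, 1]\<close> on \<open>J\<close>. The theorem follows by moving a certificate of the given solution
  continuously with \<open>(y, l)\<close>.
  
  Applying \<open>A\<^sup>[\<^sup>J\<^sup>]\<close> to the certificate equation shows that the given solution is the candidate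
  \<open>x\<^sub>l(y)\<close> (\<open>solution_eq_candidate\<close>). For every \<open>(y', l')\<close>, the residual of the candidate
  is an explicit combination of \<open>\<Pi>y'\<close>, \<open>\<Omega>s\<close> and \<open>D\<^sub>I s\<close>, where \<open>\<Pi>\<close> and \<open>\<Omega>\<close> are the two
  tilde operators (\<open>residual_of_candidate\<close>). For \<open>l' > 0\<close>, a vector \<open>\<sigma>'\<close> that equals \<open>s\<close> off \<open>J\<close>
  therefore satisfies the certificate equation as soon as
  \<open>D\<^sub>J (\<sigma>' - \<sigma>)\<^sub>J = \<Pi>(y/l - y'/l')\<close>.
  
  The entries of \<open>\<sigma>\<close> on \<open>K = {i \<in> J. \<bar>\<sigma>\<^sub>i\<bar> = 1}\<close> admit no perturbation in general, since they could
  leave \<open>[-1, 1]\<close>; those on \<open>J - K\<close> may move freely a little. So it suffices to solve the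
  equation with a correction supported on \<open>J - K\<close>, which is possible for all right-hand sides, with
  a correction depending linearly on \<open>y/l - y'/l'\<close>, if \<open>Im \<Pi> \<subseteq> Im D\<^sub>J\<^sub>-\<^sub>K\<close>. This inclusion is what
  avoiding the transition space provides: projecting the certificate equation onto the cospace of
  \<open>J - K\<close> annihilates the free entries of \<open>\<sigma>\<close> and leaves precisely the equation that defines the
  piece of the transition space given by \<open>J\<close>, \<open>K\<close>, \<open>s\<close> and \<open>\<sigma>\<^sub>K\<close>, so if the inclusion failed,
  \<open>(y, l)\<close> would lie on that piece (\<open>image_Pi_tilde_outside_transition_space\<close>).
  
  What remains are finitely many strict inequalities, namely that the signs of the candidate off
  \<open>J\<close> stay equal to \<open>s\<close> and that the entries of \<open>\<sigma>'\<close> on \<open>J - K\<close> stay in \<open>(-1, 1)\<close>; they hold at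
  \<open>(y, l)\<close> and hence in a neighborhood of it.
\<close>

section \<open>Subgradients of the analysis regularizer\<close>

text \<open>
  The subdifferential of the \<open>\<ell>\<^sup>1\<close> norm. The product condition forces \<open>\<sigma>\<^sub>i\<close> to be the sign of
  \<open>v\<^sub>i\<close> wherever \<open>v\<^sub>i \<noteq> 0\<close>, and stated this way the set is visibly closed and convex.
\<close>

definition l1_subgradients :: "real^'p \<Rightarrow> (real^'p) set" where
  "l1_subgradients v = {\<sigma>. \<forall>i. \<bar>\<sigma> $ i\<bar> \<le> 1 \<and> \<sigma> $ i * v $ i = \<bar>v $ i\<bar>}"

lemma inner_transpose_mult_vec: "v \<bullet> (transpose M *v w) = (M *v v) \<bullet> w"
  for M :: "real^'n^'m"
  by (metis dot_lmul_matrix inner_commute transpose_matrix_vector)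

lemma cols_mult_vec: "cols M L *v v = M *v entries v L"
  unfolding cols_def entries_def matrix_vector_mult_def
  by (auto simp: vec_eq_iff intro!: sum.cong)

lemma cospace_iff: "x \<in> cospace D J \<longleftrightarrow> (\<forall>i\<in>J. (transpose D *v x) $ i = 0)"
proof -
  have "(transpose (cols D J) *v x) $ i = (if i \<in> J then (transpose D *v x) $ i else 0)" for i
    by (simp add: cols_def transpose_def matrix_vector_mult_def)
  then show ?thesis
    unfolding cospace_def null_space_def by (auto simp: vec_eq_iff)
qed

lemma subspace_cospace: "subspace (cospace D J)"
  unfolding subspace_def
  by (auto simp: cospace_iff matrix_vector_mult_scaleR matrix_vector_right_distrib
      simp del: transpose_matrix_vector)

lemma cospace_orthogonal_image:
  assumes "g \<in> cospace D L"
  shows "g \<bullet> (cols D L *v v) = 0"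
proof -
  have "g \<bullet> (cols D L *v v) = (transpose D *v g) \<bullet> entries v L"
    by (metis cols_mult_vec inner_commute inner_transpose_mult_vec)
  also have "\<dots> = 0"
    using assms unfolding cospace_iff inner_vec_def entries_def by (auto intro!: sum.neutral)
  finally show ?thesis .
qed

lemma l1_subgradients_inner_self:
  "\<sigma> \<in> l1_subgradients v \<Longrightarrow> \<sigma> \<bullet> v = l1_norm v"
  unfolding l1_subgradients_def l1_norm_def inner_vec_def by simp

lemma l1_subgradients_inner_le:
  assumes "\<sigma> \<in> l1_subgradients v"
  shows "\<sigma> \<bullet> w \<le> l1_norm w"
  unfolding l1_norm_def inner_vec_def
proof (rule sum_mono)
  fix i
  have "\<sigma> $ i * w $ i \<le> \<bar>\<sigma> $ i\<bar> * \<bar>w $ i\<bar>"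
    by (metis abs_ge_self abs_mult)
  also have "\<dots> \<le> 1 * \<bar>w $ i\<bar>"
    using assms unfolding l1_subgradients_def by (intro mult_right_mono) auto
  finally show "\<sigma> $ i \<bullet> w $ i \<le> \<bar>w $ i\<bar>" by simp
qed

lemma convex_l1_subgradients: "convex (l1_subgradients v)"
proof (rule convexI)
  fix \<sigma> \<tau> :: "real^'a" and a b :: real
  assume *: "\<sigma> \<in> l1_subgradients v" "\<tau> \<in> l1_subgradients v" "0 \<le> a" "0 \<le> b" "a + b = 1"
  show "a *\<^sub>R \<sigma> + b *\<^sub>R \<tau> \<in> l1_subgradients v"
    unfolding l1_subgradients_def
  proof (clarify, intro conjI)
    fix i
    have s: "\<bar>\<sigma> $ i\<bar> \<le> 1" "\<bar>\<tau> $ i\<bar> \<le> 1" "\<sigma> $ i * v $ i = \<bar>v $ i\<bar>" "\<tau> $ i * v $ i = \<bar>v $ i\<bar>"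
      using * unfolding l1_subgradients_def by auto
    have "\<bar>a * \<sigma> $ i + b * \<tau> $ i\<bar> \<le> a * \<bar>\<sigma> $ i\<bar> + b * \<bar>\<tau> $ i\<bar>"
      using *(3,4) by (metis abs_mult abs_of_nonneg abs_triangle_ineq)
    also have "\<dots> \<le> a * 1 + b * 1"
      using s *(3,4) by (intro add_mono mult_left_mono) auto
    finally show "\<bar>(a *\<^sub>R \<sigma> + b *\<^sub>R \<tau>) $ i\<bar> \<le> 1" using *(5) by simp
    have "(a * \<sigma> $ i + b * \<tau> $ i) * v $ i = (a + b) * \<bar>v $ i\<bar>"
      using s by (simp add: algebra_simps)
    then show "(a *\<^sub>R \<sigma> + b *\<^sub>R \<tau>) $ i * v $ i = \<bar>v $ i\<bar>" using *(5) by simp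
  qed
qed

lemma compact_l1_subgradients: "compact (l1_subgradients v)"
proof -
  have "closed (l1_subgradients v)"
    unfolding l1_subgradients_def
    by (intro closed_Collect_all closed_Collect_conj closed_Collect_le closed_Collect_eq
        continuous_intros)
  moreover have "bounded (l1_subgradients v)"
  proof (rule boundedI)
    fix \<sigma> assume "\<sigma> \<in> l1_subgradients v"
    then have "(\<Sum>i\<in>UNIV. \<bar>\<sigma> $ i\<bar>) \<le> (\<Sum>i\<in>(UNIV::'a set). 1)"
      unfolding l1_subgradients_def by (intro sum_mono) auto
    then show "norm \<sigma> \<le> real CARD('a)"
      using norm_le_l1_cart[of \<sigma>] by simp
  qed
  ultimately show ?thesis by (simp add: compact_eq_bounded_closed)
qed

text \<open>
  Directional derivatives of the \<open>\<ell>\<^sup>1\<close> norm are attained by a subgradient: on the zero entries of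
  \<open>u\<close> it takes the sign of the direction. The first-order expansion is exact for small steps since
  the norm is piecewise linear.
\<close>

lemma l1_directional_subgradient:
  obtains \<sigma> where "\<sigma> \<in> l1_subgradients u"
    "\<forall>\<^sub>F t in at_right 0. l1_norm (u + t *\<^sub>R p) = l1_norm u + t * (\<sigma> \<bullet> p)"
proof
  define \<sigma> :: "real^'a" where "\<sigma> = (\<chi> i. if u $ i = 0 then sgn (p $ i) else sgn (u $ i))"
  show "\<sigma> \<in> l1_subgradients u"
    unfolding l1_subgradients_def \<sigma>_def by (auto simp: abs_sgn sgn_if)
  have "\<forall>\<^sub>F t in at_right 0. u $ i \<noteq> 0 \<longrightarrow> \<bar>t * p $ i\<bar> < \<bar>u $ i\<bar>" for i
  proof (cases "u $ i = 0")
    case False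
    have "((\<lambda>t. \<bar>t * p $ i\<bar>) \<longlongrightarrow> \<bar>0 * p $ i\<bar>) (at_right 0)"
      by (intro tendsto_intros)
    then show ?thesis
      using order_tendstoD(2)[where a = "\<bar>u $ i\<bar>"] False by fastforce
  qed auto
  then have "\<forall>\<^sub>F t in at_right 0. \<forall>i. u $ i \<noteq> 0 \<longrightarrow> \<bar>t * p $ i\<bar> < \<bar>u $ i\<bar>"
    by (rule eventually_all_finite)
  then show "\<forall>\<^sub>F t in at_right 0. l1_norm (u + t *\<^sub>R p) = l1_norm u + t * (\<sigma> \<bullet> p)"
    using eventually_at_right_less[of "0::real"]
  proof eventually_elim
    case (elim t)
    have "\<bar>u $ i + t * p $ i\<bar> = \<bar>u $ i\<bar> + t * (\<sigma> $ i * p $ i)" for i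
    proof (cases "u $ i = 0")
      case True
      then show ?thesis using elim(2) by (simp add: \<sigma>_def abs_mult sgn_if)
    next
      case False
      then have "\<bar>t * p $ i\<bar> < \<bar>u $ i\<bar>" using elim(1) by auto
      then show ?thesis using False by (cases "u $ i > 0") (auto simp: \<sigma>_def)
    qed
    then show ?case
      by (simp add: l1_norm_def inner_vec_def sum.distrib sum_distrib_left)
  qed
qed

section \<open>Optimality certificates\<close>

lemma objective_along_line:
  "objective \<Phi> D y l (x + t *\<^sub>R v) =
     objective \<Phi> D y l x + t\<^sup>2 / 2 * (norm (\<Phi> *v v))\<^sup>2
     - t * (v \<bullet> (transpose \<Phi> *v (y - \<Phi> *v x)))
     + l * (l1_norm (transpose D *v x + t *\<^sub>R (transpose D *v v)) - l1_norm (transpose D *v x))"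
proof -
  have e: "v \<bullet> (transpose \<Phi> *v (y - \<Phi> *v x)) = (\<Phi> *v v) \<bullet> (y - \<Phi> *v x)"
    by (rule inner_transpose_mult_vec)
  have "y - \<Phi> *v (x + t *\<^sub>R v) = (y - \<Phi> *v x) - t *\<^sub>R (\<Phi> *v v)"
    by (simp add: matrix_vector_right_distrib matrix_vector_mult_scaleR)
  then have "(norm (y - \<Phi> *v (x + t *\<^sub>R v)))\<^sup>2 =
    (norm (y - \<Phi> *v x))\<^sup>2 - 2 * t * ((\<Phi> *v v) \<bullet> (y - \<Phi> *v x)) + t\<^sup>2 * (norm (\<Phi> *v v))\<^sup>2"
    unfolding power2_norm_eq_inner
    by (simp add: inner_diff_left inner_diff_right inner_commute power2_eq_square algebra_simps)
  then show ?thesis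
    unfolding objective_def e
    by (simp add: matrix_vector_right_distrib matrix_vector_mult_scaleR algebra_simps)
qed

text \<open>
  Sufficiency is the subgradient inequality. For necessity, the vectors \<open>l D\<sigma>\<close> form a compact
  convex set; if it missed \<open>\<Phi>\<^sup>*(y - \<Phi>x)\<close>, a separating hyperplane would give a direction in which
  the objective strictly decreases to first order.
\<close>

lemma is_solution_iff_certificate:
  assumes "l \<ge> 0"
  shows "is_solution \<Phi> D y l x \<longleftrightarrow>
    (\<exists>\<sigma>\<in>l1_subgradients (transpose D *v x). transpose \<Phi> *v (y - \<Phi> *v x) = l *\<^sub>R (D *v \<sigma>))"
proof
  let ?w = "transpose \<Phi> *v (y - \<Phi> *v x)" and ?u = "transpose D *v x"
  have adj: "v \<bullet> (D *v \<sigma>) = \<sigma> \<bullet> (transpose D *v v)" for v \<sigma>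
    by (metis inner_transpose_mult_vec inner_commute)
  {
    assume sol: "is_solution \<Phi> D y l x"
    let ?C = "(\<lambda>\<sigma>. l *\<^sub>R (D *v \<sigma>)) ` l1_subgradients ?u"
    have lin: "linear (\<lambda>\<sigma>. l *\<^sub>R (D *v \<sigma>))"
      by (intro linear_compose_scale_right matrix_vector_mul_linear)
    have "?w \<in> ?C"
    proof (rule ccontr)
      assume "?w \<notin> ?C"
      moreover have "convex ?C"
        by (rule convex_linear_image[OF lin convex_l1_subgradients])
      moreover have "closed ?C"
        by (intro compact_imp_closed compact_continuous_image compact_l1_subgradients
            linear_continuous_on) (use lin in \<open>simp add: linear_conv_bounded_linear\<close>)
      ultimately obtain a b where ab: "a \<bullet> ?w < b" "\<forall>c\<in>?C. a \<bullet> c > b"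
        using separating_hyperplane_closed_point by metis
      \<comment> \<open>The separating functional is larger on the set, so descent is in the opposite direction.\<close>
      define v where "v = - a"
      obtain \<sigma> where \<sigma>: "\<sigma> \<in> l1_subgradients ?u" and
        ev: "\<forall>\<^sub>F t in at_right 0.
          l1_norm (?u + t *\<^sub>R (transpose D *v v)) = l1_norm ?u + t * (\<sigma> \<bullet> (transpose D *v v))"
        by (rule l1_directional_subgradient)
      \<comment> \<open>The rate of descent of the objective at \<open>x\<close> in direction \<open>v\<close>; separation makes it positive, while minimality bounds it by a quantity that vanishes with the step length.\<close>
      define d where "d = v \<bullet> ?w - l * (\<sigma> \<bullet> (transpose D *v v))"
      have "a \<bullet> ?w < a \<bullet> (l *\<^sub>R (D *v \<sigma>))"
        using ab \<sigma> by force
      then have "d > 0"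
        unfolding d_def adj[symmetric] v_def by simp
      have "\<forall>\<^sub>F t in at_right 0. d \<le> t / 2 * (norm (\<Phi> *v v))\<^sup>2"
        using ev eventually_at_right_less[of "0::real"]
      proof eventually_elim
        case (elim t)
        have "objective \<Phi> D y l x \<le> objective \<Phi> D y l (x + t *\<^sub>R v)"
          using sol by (simp add: is_solution_def)
        then have "0 \<le> t * (t / 2 * (norm (\<Phi> *v v))\<^sup>2 - d)"
          unfolding objective_along_line elim(1) d_def
          by (simp add: algebra_simps power2_eq_square)
        then show ?case using elim(2) by (simp add: zero_le_mult_iff)
      qed
      moreover have "((\<lambda>t. t / 2 * (norm (\<Phi> *v v))\<^sup>2) \<longlongrightarrow> 0 / 2 * (norm (\<Phi> *v v))\<^sup>2) (at_right 0)"
        by (intro tendsto_intros) auto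
      ultimately have "d \<le> 0 / 2 * (norm (\<Phi> *v v))\<^sup>2"
        by (intro tendsto_lowerbound) auto
      with \<open>d > 0\<close> show False by simp
    qed
    then show "\<exists>\<sigma>\<in>l1_subgradients ?u. ?w = l *\<^sub>R (D *v \<sigma>)" by auto
  next
    assume "\<exists>\<sigma>\<in>l1_subgradients ?u. ?w = l *\<^sub>R (D *v \<sigma>)"
    then obtain \<sigma> where \<sigma>: "\<sigma> \<in> l1_subgradients ?u" and w: "?w = l *\<^sub>R (D *v \<sigma>)" by blast
    show "is_solution \<Phi> D y l x"
      unfolding is_solution_def
    proof
      fix z
      let ?v = "z - x"
      have "l1_norm ?u + \<sigma> \<bullet> (transpose D *v ?v) \<le> l1_norm (?u + transpose D *v ?v)"
        using l1_subgradients_inner_le[OF \<sigma>, of "?u + transpose D *v ?v"]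
          l1_subgradients_inner_self[OF \<sigma>] by (simp add: inner_add_right)
      then have "l * (\<sigma> \<bullet> (transpose D *v ?v))
          \<le> l * (l1_norm (?u + transpose D *v ?v) - l1_norm ?u)"
        using assms by (intro mult_left_mono) auto
      then have "?v \<bullet> ?w \<le> l * (l1_norm (?u + transpose D *v ?v) - l1_norm ?u)"
        unfolding w by (simp add: adj)
      then show "objective \<Phi> D y l x \<le> objective \<Phi> D y l z"
        using objective_along_line[of \<Phi> D y l x 1 ?v] by simp
    qed
  }
qed

section \<open>The operator \<open>A\<^sup>[\<^sup>J\<^sup>]\<close>\<close>

text \<open>
  A subspace has a basis of at most \<open>CARD('n)\<close> vectors; these are placed in distinct columns, and the
  other columns are zero. Zero is not a basis vector, so the nonzero columns are exactly the basis.
\<close>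

lemma exists_basis_matrix:
  fixes G :: "(real^'n) set"
  assumes "subspace G"
  shows "\<exists>U. is_basis_matrix U G"
proof -
  obtain B where B: "B \<subseteq> G" "independent B" "G \<subseteq> span B" "card B = dim G"
    by (rule basis_exists)
  have fin: "finite B" using B(2) by (simp add: independent_imp_finite)
  have "card B \<le> CARD('n)"
    unfolding B(4) using dim_subset_UNIV_cart[of G] by simp
  then obtain f :: "real^'n \<Rightarrow> 'n" where f: "inj_on f B"
    using card_le_inj[OF fin, of "UNIV :: 'n set"] by auto
  define U :: "real^'n^'n" where
    "U = (\<chi> i k. if k \<in> f ` B then inv_into B f k $ i else 0)"
  have col: "column k U = (if k \<in> f ` B then inv_into B f k else 0)" for k
    by (simp add: U_def column_def vec_eq_iff)
  have "0 \<notin> B" using B(2) dependent_zero by blast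
  then have supp: "col_support U = f ` B"
    unfolding col_support_def col using f by auto
  have img: "(\<lambda>k. column k U) ` (f ` B) = B"
    unfolding col image_image using f by (simp add: cong: image_cong)
  have "span B = G"
    using B assms by (simp add: span_subspace)
  moreover have "inj_on (\<lambda>k. column k U) (f ` B)"
    using inj_on_inv_into[of "f ` B" f B] by (simp add: col inj_on_def)
  ultimately show ?thesis
    using B(2) by (intro exI[of _ U]) (simp add: is_basis_matrix_def supp img)
qed

lemma basis_matrix_props:
  fixes G :: "(real^'n) set"
  assumes "subspace G"
  defines "U \<equiv> basis_matrix G"
  shows "U *v c \<in> G"
    and "x \<in> G \<Longrightarrow> \<exists>c. x = U *v c"
    and "U *v c = U *v entries c (col_support U)"
    and "U *v c = 0 \<Longrightarrow> entries c (col_support U) = 0"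
proof -
  let ?S = "col_support U"
  have "is_basis_matrix U G"
    unfolding U_def basis_matrix_def using exists_basis_matrix[OF assms(1)] by (rule someI_ex)
  then have inj: "inj_on (\<lambda>k. column k U) ?S"
    and ind: "independent ((\<lambda>k. column k U) ` ?S)"
    and span: "span ((\<lambda>k. column k U) ` ?S) = G"
    unfolding is_basis_matrix_def by auto
  have sum: "U *v c = (\<Sum>k\<in>?S. c $ k *s column k U)" for c
    unfolding matrix_mult_sum
    by (rule sum.mono_neutral_right) (auto simp: col_support_def)
  show mem: "U *v c \<in> G" for c
    unfolding sum span[symmetric]
    unfolding scalar_mult_eq_scaleR by (intro span_sum span_scale span_base imageI)
  show "U *v c = U *v entries c ?S" for c
    unfolding sum by (intro sum.cong) (auto simp: entries_def)
  show "\<exists>c. x = U *v c" if x: "x \<in> G" for x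
  proof -
    obtain u where "x = (\<Sum>v\<in>(\<lambda>k. column k U) ` ?S. u v *\<^sub>R v)"
      using x unfolding span[symmetric] by (auto simp: span_finite)
    then have "x = U *v (\<chi> k. u (column k U))"
      unfolding sum by (simp add: sum.reindex[OF inj] scalar_mult_eq_scaleR)
    then show ?thesis by blast
  qed
  show "entries c ?S = 0" if "U *v c = 0" for c
  proof -
    let ?f = "\<lambda>v. c $ (inv_into ?S (\<lambda>k. column k U) v)"
    have "(\<Sum>v\<in>(\<lambda>k. column k U) ` ?S. ?f v *\<^sub>R v) = U *v c"
      unfolding sum by (simp add: sum.reindex[OF inj] scalar_mult_eq_scaleR inv_into_f_f[OF inj])
    then have "?f v = 0" if "v \<in> (\<lambda>k. column k U) ` ?S" for v
      using ind that \<open>U *v c = 0\<close> independentD[OF ind _ subset_refl, of ?f v] by simp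
    then have "c $ k = 0" if "k \<in> ?S" for k
      using that inv_into_f_f[OF inj that] by (metis imageI)
    then show ?thesis by (simp add: entries_def vec_eq_iff)
  qed
qed

lemma cols_mat_1_mult_vec: "cols (mat 1) S *v c = entries c S"
  by (simp add: cols_mult_vec)

text \<open>
  A matrix that lives on the block \<open>S\<close> and is injective there becomes invertible after adding the
  identity on the complementary block. This sum commutes with the projection onto the block, so its
  inverse cut down to the block is the required block inverse.
\<close>

lemma block_inv_left_inverse:
  fixes M :: "real^'n^'n"
  assumes rows: "\<And>c. entries (M *v c) S = M *v c"
    and columns: "\<And>c. M *v entries c S = M *v c"
    and inj: "\<And>c. M *v c = 0 \<Longrightarrow> entries c S = 0"
  shows "block_inv S M *v (M *v c) = entries c S"
proof -
  let ?E = "cols (mat 1) S :: real^'n^'n"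
  define N where "N = M + (mat 1 - ?E)"
  have N: "N *v c = M *v c + (c - entries c S)" for c
    by (simp add: N_def matrix_vector_mult_add_rdistrib matrix_vector_mult_diff_rdistrib
        cols_mat_1_mult_vec)
  have ent: "entries (a + b) S = entries a S + entries b S"
    "entries (a - b) S = entries a S - entries b S"
    "entries (entries a S) S = entries a S" for a b :: "real^'n"
    by (auto simp: entries_def vec_eq_iff)
  have "c = 0" if "N *v c = 0" for c
  proof -
    have "entries (N *v c) S = M *v c" by (simp add: N ent rows)
    moreover have "entries 0 S = 0" by (simp add: entries_def vec_eq_iff)
    ultimately have "M *v c = 0" using that by simp
    then show ?thesis using that inj[of c] by (simp add: N)
  qed
  then obtain V where VN: "V ** N = mat 1"
    using matrix_left_invertible_ker by blast
  then have NV: "N ** V = mat 1" by (simp add: matrix_left_right_inverse)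
  have EN: "?E ** N = M" and NE: "N ** ?E = M"
    by (simp_all add: matrix_eq matrix_vector_mul_assoc[symmetric] cols_mat_1_mult_vec N ent
        rows columns)
  have EE: "?E ** ?E = ?E"
    by (simp add: matrix_eq matrix_vector_mul_assoc[symmetric] cols_mat_1_mult_vec ent)
  have VE: "V ** ?E = ?E ** V"
    by (metis EN NE NV VN matrix_mul_assoc matrix_mul_lid matrix_mul_rid)
  have ME: "M ** ?E = M" "?E ** M = M"
    by (simp_all add: matrix_eq matrix_vector_mul_assoc[symmetric] cols_mat_1_mult_vec
        rows columns)
  define W where "W = ?E ** V ** ?E"
  have W: "W = V ** ?E" "W = ?E ** V"
    unfolding W_def using VE EE by (metis matrix_mul_assoc)+
  have "M ** W = ?E"
    using NE NV EE VE W ME by (metis matrix_mul_assoc matrix_mul_rid matrix_mul_lid)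
  moreover have "W ** M = ?E"
    using EN VN NE EE VE W ME by (metis matrix_mul_assoc matrix_mul_rid matrix_mul_lid)
  moreover have "W $ i $ j = 0" if "i \<notin> S \<or> j \<notin> S" for i j
    using that
  proof
    assume "i \<notin> S"
    then show ?thesis unfolding W(2)
      by (auto simp: matrix_matrix_mult_def cols_def mat_def intro!: sum.neutral)
  next
    assume "j \<notin> S"
    then show ?thesis unfolding W(1)
      by (auto simp: matrix_matrix_mult_def cols_def mat_def intro!: sum.neutral)
  qed
  ultimately have "\<exists>W. (\<forall>i j. i \<notin> S \<or> j \<notin> S \<longrightarrow> W $ i $ j = 0) \<and> M ** W = ?E \<and> W ** M = ?E"
    by blast
  then have "block_inv S M ** M = ?E"
    unfolding block_inv_def by (rule someI2_ex) blast
  then show ?thesis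
    by (simp add: matrix_vector_mul_assoc cols_mat_1_mult_vec)
qed

lemma A_op_in_cospace: "A_op \<Phi> D J *v v \<in> cospace D J"
  unfolding A_op_def Let_def matrix_vector_mul_assoc[symmetric]
  by (rule basis_matrix_props(1)[OF subspace_cospace])

text \<open>
  The columns of the basis matrix lie in the cospace, which is orthogonal to the image of \<open>D\<^sub>J\<close>.
\<close>

lemma A_op_annihilates: "A_op \<Phi> D J *v (cols D J *v v) = 0"
proof -
  let ?U = "basis_matrix (cospace D J)"
  let ?z = "transpose ?U *v (cols D J *v v)"
  have "c \<bullet> ?z = 0" for c
    using cospace_orthogonal_image[OF basis_matrix_props(1)[OF subspace_cospace[of D J], of c]]
    by (simp only: inner_transpose_mult_vec)
  then have "?z = 0" by (metis inner_eq_zero_iff)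
  then show ?thesis
    unfolding A_op_def Let_def by (simp add: matrix_vector_mul_assoc[symmetric])
qed

text \<open>
  In coordinates \<open>x = Uc\<close> this is the definition of \<open>A\<^sup>[\<^sup>J\<^sup>]\<close>, once the Gram matrix
  \<open>U\<^sup>*\<Phi>\<^sup>*\<Phi>U\<close> is known to be injective on the block of the nonzero columns: its quadratic form at
  \<open>c\<close> is \<open>\<parallel>\<Phi>Uc\<parallel>\<^sup>2\<close>, and \<open>\<Phi>\<close> is injective on the cospace.
\<close>

lemma A_op_left_inverse:
  assumes H: "cond_H \<Phi> D J" and x: "x \<in> cospace D J"
  shows "A_op \<Phi> D J *v (transpose \<Phi> *v (\<Phi> *v x)) = x"
proof -
  let ?U = "basis_matrix (cospace D J)"
  let ?S = "col_support ?U"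
  let ?M = "transpose ?U ** transpose \<Phi> ** \<Phi> ** ?U"
  note U = basis_matrix_props[OF subspace_cospace[of D J]]
  have M: "?M *v c = transpose ?U *v (transpose \<Phi> *v (\<Phi> *v (?U *v c)))" for c
    by (simp add: matrix_vector_mul_assoc matrix_mul_assoc)
  obtain c where c: "x = ?U *v c" using U(2)[OF x] by blast
  have "block_inv ?S ?M *v (?M *v c) = entries c ?S"
  proof (rule block_inv_left_inverse)
    fix c
    have "(transpose ?U *v w) $ k = 0" if "k \<notin> ?S" for k w
      using that
      by (simp add: col_support_def matrix_vector_mult_def transpose_def column_def vec_eq_iff)
    then show "entries (?M *v c) ?S = ?M *v c"
      unfolding M by (auto simp: entries_def vec_eq_iff)
    show "?M *v entries c ?S = ?M *v c"
      unfolding M U(3)[symmetric] ..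
    assume "?M *v c = 0"
    then have "c \<bullet> (transpose ?U *v (transpose \<Phi> *v (\<Phi> *v (?U *v c)))) = 0"
      unfolding M by simp
    then have "\<Phi> *v (?U *v c) = 0"
      by (simp only: inner_transpose_mult_vec inner_eq_zero_iff)
    then have "?U *v c = 0"
      using H U(1)[of c] unfolding cond_H_def null_space_def by blast
    then show "entries c ?S = 0" by (rule U(4))
  qed
  then have "A_op \<Phi> D J *v (transpose \<Phi> *v (\<Phi> *v x)) = ?U *v entries c ?S"
    unfolding A_op_def Let_def matrix_vector_mul_assoc[symmetric] c[symmetric] by metis
  then show ?thesis using U(3)[of c] c by simp
qed

section \<open>Orthogonal projectors\<close>

lemma orth_proj_eqI:
  assumes "subspace G" "p \<in> G" "\<And>g. g \<in> G \<Longrightarrow> orthogonal (x - p) g"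
  shows "orth_proj G x = p"
  unfolding orth_proj_def
proof (rule the_equality)
  fix q assume q: "q \<in> G \<and> (\<forall>g\<in>G. orthogonal (x - q) g)"
  have "p - q \<in> G" using assms q by (simp add: subspace_diff)
  then have "orthogonal (x - q) (p - q)" "orthogonal (x - p) (p - q)"
    using assms q by auto
  then have "(p - q) \<bullet> (p - q) = 0"
    unfolding orthogonal_def by (simp add: inner_diff_left)
  then show "q = p" by simp
qed (use assms in auto)

lemma orth_proj_props:
  assumes "subspace G"
  shows "orth_proj G x \<in> G" "g \<in> G \<Longrightarrow> orthogonal (x - orth_proj G x) g"
proof -
  obtain p z where p: "p \<in> span G" and z: "\<And>w. w \<in> span G \<Longrightarrow> orthogonal z w" and "x = p + z"
    using orthogonal_subspace_decomp_exists[of G x] by metis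
  moreover have "span G = G" using assms by simp
  ultimately have "orth_proj G x = p"
    by (intro orth_proj_eqI[OF assms]) auto
  then show "orth_proj G x \<in> G" "g \<in> G \<Longrightarrow> orthogonal (x - orth_proj G x) g"
    using p z \<open>x = p + z\<close> \<open>span G = G\<close> by auto
qed

lemma orth_proj_scaleR_add:
  assumes "subspace G" "\<And>g. g \<in> G \<Longrightarrow> orthogonal z g"
  shows "orth_proj G (l *\<^sub>R x + z) = l *\<^sub>R orth_proj G x"
proof (rule orth_proj_eqI[OF assms(1)])
  show "l *\<^sub>R orth_proj G x \<in> G"
    using assms(1) by (simp add: orth_proj_props subspace_scale)
  fix g assume g: "g \<in> G"
  have "l *\<^sub>R x + z - l *\<^sub>R orth_proj G x = l *\<^sub>R (x - orth_proj G x) + z"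
    by (simp add: algebra_simps)
  then show "orthogonal (l *\<^sub>R x + z - l *\<^sub>R orth_proj G x) g"
    using orth_proj_props(2)[OF assms(1) g, of x] assms(2)[OF g]
    by (simp only: orthogonal_def inner_add_left inner_scaleR_left)
qed

section \<open>Candidate solutions and the transition space\<close>

lemma image_subset_imp_matrix_factor:
  fixes M :: "real^'q^'n" and N :: "real^'p^'n"
  assumes "image_space M \<subseteq> image_space N"
  obtains R where "N ** R = M"
proof -
  have "\<exists>r. N *v r = M *v axis j 1" for j
    using assms unfolding image_space_def by (metis rangeE rangeI subsetD)
  then obtain r where r: "\<And>j. N *v r j = M *v axis j 1" by metis
  have "(N ** (\<chi> i j. r j $ i)) $ i $ j = M $ i $ j" for i j
  proof -
    have "(N ** (\<chi> i j. r j $ i)) $ i $ j = (N *v r j) $ i"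
      by (simp add: matrix_matrix_mult_def matrix_vector_mult_def)
    then show ?thesis by (simp add: r matrix_vector_mult_basis column_def)
  qed
  then show thesis by (intro that[of "\<chi> i j. r j $ i"]) (simp add: vec_eq_iff)
qed

text \<open>
  The residual is affine in \<open>(y, l)\<close> for a fixed sign vector, which reduces the persistence of
  certificates to linear algebra.
\<close>

lemma residual_of_candidate:
  assumes "xh = A_op \<Phi> D J *v (transpose \<Phi> *v y)
    - l *\<^sub>R (A_op \<Phi> D J *v (cols D (-J) *v s))"
  shows "transpose \<Phi> *v (y - \<Phi> *v xh) =
    l *\<^sub>R (Omega_tilde \<Phi> D J *v s + cols D (-J) *v s) - Pi_tilde \<Phi> D J *v y"
  unfolding assms Pi_tilde_def Omega_tilde_def matrix_vector_mul_assoc[symmetric]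
    matrix_vector_mult_diff_rdistrib
  by (simp add: matrix_vector_mult_diff_distrib matrix_vector_mult_scaleR algebra_simps)

text \<open>
  Apply \<open>A\<^sup>[\<^sup>J\<^sup>]\<close> to the certificate equation: it inverts \<open>\<Phi>\<^sup>*\<Phi>\<close> on the cospace and kills the
  part of \<open>D\<sigma>\<close> supported on \<open>J\<close>.
\<close>

lemma solution_eq_candidate:
  assumes H: "cond_H \<Phi> D J" and x: "x \<in> cospace D J"
    and cert: "transpose \<Phi> *v (y - \<Phi> *v x) = l *\<^sub>R (D *v \<sigma>)"
  shows "x = A_op \<Phi> D J *v (transpose \<Phi> *v y)
    - l *\<^sub>R (A_op \<Phi> D J *v (cols D (-J) *v \<sigma>))"
proof -
  let ?A = "A_op \<Phi> D J"
  have "D *v \<sigma> = cols D J *v \<sigma> + cols D (-J) *v \<sigma>"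
    unfolding cols_mult_vec matrix_vector_right_distrib[symmetric]
    by (rule arg_cong[where f = "(*v) D"]) (simp add: entries_def vec_eq_iff)
  then have "?A *v (D *v \<sigma>) = ?A *v (cols D (-J) *v \<sigma>)"
    by (simp add: matrix_vector_right_distrib A_op_annihilates)
  moreover have "?A *v (transpose \<Phi> *v (y - \<Phi> *v x)) = ?A *v (transpose \<Phi> *v y) - x"
    by (simp add: matrix_vector_mult_diff_distrib A_op_left_inverse[OF H x]
        del: transpose_matrix_vector)
  ultimately show ?thesis
    unfolding cert by (simp add: matrix_vector_mult_scaleR algebra_simps)
qed

text \<open>
  The hypothesis on \<open>\<sigma>\<close> is the certificate equation of the solution at \<open>(y, l)\<close>, rewritten with the
  tilde operators. Its entries on \<open>J\<close> that are not saturated contribute a vector of \<open>Im D\<^sub>J\<^sub>-\<^sub>K\<close>, which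
  vanishes under the projector onto the cospace of \<open>J - K\<close>; the saturated ones form the sign pattern
  \<open>\<sigma>\<^sub>K\<close>. What is left is the equation of a piece of the transition space, and the only way
  for \<open>(y, l)\<close> to avoid that piece is that it is excluded from the union, i.e. that the
  asserted inclusion holds.
\<close>

lemma image_Pi_tilde_outside_transition_space:
  assumes "(y, l) \<notin> transition_space \<Phi> D" "l \<ge> 0" "cond_H \<Phi> D J"
    and s: "s \<in> sign_patterns (-J)"
    and bal: "l *\<^sub>R (Omega_tilde \<Phi> D J *v s) - Pi_tilde \<Phi> D J *v y = l *\<^sub>R (cols D J *v \<sigma>)"
  shows "image_space (Pi_tilde \<Phi> D J) \<subseteq> image_space (cols D (J - {i. \<bar>\<sigma> $ i\<bar> = 1}))"
proof (rule ccontr)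
  define K where "K = {i\<in>J. \<bar>\<sigma> $ i\<bar> = 1}"
  have JK: "J - {i. \<bar>\<sigma> $ i\<bar> = 1} = J - K" unfolding K_def by auto
  assume "\<not> ?thesis"
  then have nsub: "\<not> image_space (Pi_tilde \<Phi> D J) \<subseteq> image_space (cols D (J - K))"
    unfolding JK .
  let ?b = "Omega_tilde \<Phi> D J *v s - cols D K *v entries \<sigma> K"
  have "cols D J *v \<sigma> = cols D K *v entries \<sigma> K + cols D (J - K) *v \<sigma>"
    unfolding cols_mult_vec matrix_vector_right_distrib[symmetric]
    by (rule arg_cong[where f = "(*v) D"]) (auto simp: entries_def vec_eq_iff K_def)
  then have "Pi_tilde \<Phi> D J *v y = l *\<^sub>R ?b + (- l) *\<^sub>R (cols D (J - K) *v \<sigma>)"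
    using bal by (simp add: algebra_simps)
  moreover have "orthogonal ((- l) *\<^sub>R (cols D (J - K) *v \<sigma>)) g" if "g \<in> cospace D (J - K)" for g
    using cospace_orthogonal_image[OF that, of \<sigma>]
    by (simp add: orthogonal_def inner_commute)
  ultimately have "orth_proj (cospace D (J - K)) (Pi_tilde \<Phi> D J *v y) =
      l *\<^sub>R orth_proj (cospace D (J - K)) ?b"
    by (simp only: orth_proj_scaleR_add[OF subspace_cospace])
  then have "(y, l) \<in> transition_part \<Phi> D J K s (entries \<sigma> K)"
    unfolding transition_part_def using \<open>l \<ge> 0\<close> by simp
  moreover have "entries \<sigma> K \<in> sign_patterns K"
    unfolding sign_patterns_def entries_def K_def by (auto simp: abs_if split: if_splits)
  moreover have "K \<subseteq> J" unfolding K_def by auto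
  ultimately have "(y, l) \<in> transition_space \<Phi> D"
    unfolding transition_space_def using assms(3) s nsub by blast
  with assms(1) show False by blast
qed

theorem theorem1:
  fixes \<Phi> :: "real^'n^'q" and D :: "real^'p^'n"
    and y :: "real^'q" and l :: real and xstar :: "real^'n"
    and I J :: "'p set" and s :: "real^'p"
    and xhat :: "real \<Rightarrow> real^'q \<Rightarrow> real^'n"
  assumes "null_space \<Phi> \<inter> null_space (transpose D) = {0}"
    and "l > 0"
    and "(y, l) \<notin> transition_space \<Phi> D"
    and "is_solution \<Phi> D y l xstar"
    and "I = D_support D xstar"
    and "J = D_cosupport D xstar"
    and "s = sign_vec (transpose D *v xstar)"
    and "cond_H \<Phi> D J"
    and "\<And>lbar ybar. lbar \<ge> 0 \<Longrightarrow>
          xhat lbar ybar =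
            A_op \<Phi> D J *v (transpose \<Phi> *v ybar)
            - lbar *\<^sub>R (A_op \<Phi> D J *v (cols D I *v entries s I))"
  shows "\<exists>B. openin (top_of_set (UNIV \<times> {0..})) B \<and> (y, l) \<in> B \<and>
           (\<forall>(ybar, lbar)\<in>B. is_solution \<Phi> D ybar lbar (xhat lbar ybar))"
proof -
  let ?P = "Pi_tilde \<Phi> D J" and ?O = "Omega_tilde \<Phi> D J" and ?A = "A_op \<Phi> D J"
  have I: "I = - J" using assms(5,6) by (simp add: D_cosupport_def)
  have u_J: "(transpose D *v xstar) $ i = 0 \<longleftrightarrow> i \<in> J" for i
    using assms(6) by (simp add: D_cosupport_def D_support_def)
  have s_nth: "s $ i = sgn ((transpose D *v xstar) $ i)" for i
    using assms(7) by (simp add: sign_vec_def)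
  have s_entries: "cols D I *v entries s I = cols D (-J) *v s"
    unfolding cols_mult_vec I
    by (rule arg_cong[where f = "(*v) D"]) (simp add: entries_def vec_eq_iff)

  define X where "X = (\<lambda>(yb, lb). ?A *v (transpose \<Phi> *v yb) - lb *\<^sub>R (?A *v (cols D (-J) *v s)))"
  have xhat: "xhat lb yb = X (yb, lb)" if "lb \<ge> 0" for lb yb
    using assms(9)[OF that] unfolding X_def s_entries by simp
  have resid: "transpose \<Phi> *v (yb - \<Phi> *v X (yb, lb)) =
      lb *\<^sub>R (?O *v s + cols D (-J) *v s) - ?P *v yb" for yb lb
    by (rule residual_of_candidate) (simp add: X_def)
  have X_J: "(transpose D *v X p) $ i = 0" if "i \<in> J" for i p
  proof -
    have "X p \<in> cospace D J"
      unfolding X_def split_beta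
      by (intro subspace_diff subspace_scale subspace_cospace A_op_in_cospace)
    then show ?thesis using that by (simp add: cospace_iff)
  qed

  obtain \<sigma> where \<sigma>: "\<sigma> \<in> l1_subgradients (transpose D *v xstar)"
    and cert: "transpose \<Phi> *v (y - \<Phi> *v xstar) = l *\<^sub>R (D *v \<sigma>)"
    using assms(2,4) is_solution_iff_certificate[of l \<Phi> D y xstar] by auto
  have \<sigma>_le: "\<bar>\<sigma> $ i\<bar> \<le> 1" for i
    using \<sigma> by (simp add: l1_subgradients_def)
  have \<sigma>_s: "\<sigma> $ i = s $ i" if "i \<notin> J" for i
  proof -
    have "\<sigma> $ i * (transpose D *v xstar) $ i = \<bar>(transpose D *v xstar) $ i\<bar>"
      using \<sigma> by (simp add: l1_subgradients_def)
    moreover have "(transpose D *v xstar) $ i \<noteq> 0" using that u_J by simp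
    ultimately show ?thesis
      unfolding s_nth by (metis abs_sgn mult.commute mult_cancel_left)
  qed
  have cols_\<sigma>: "cols D (-J) *v \<sigma> = cols D (-J) *v s"
    unfolding cols_mult_vec
    by (rule arg_cong[where f = "(*v) D"]) (use \<sigma>_s in \<open>auto simp: entries_def vec_eq_iff\<close>)
  have D_split: "D *v \<sigma> = cols D J *v \<sigma> + cols D (-J) *v s"
    unfolding cols_\<sigma>[symmetric] unfolding cols_mult_vec matrix_vector_right_distrib[symmetric]
    by (rule arg_cong[where f = "(*v) D"]) (simp add: entries_def vec_eq_iff)
  have xstar: "xstar = X (y, l)"
    using solution_eq_candidate[OF assms(8) _ cert] u_J
    by (simp add: X_def cospace_iff cols_\<sigma>)
  have bal: "l *\<^sub>R (?O *v s + cols D (-J) *v s) - ?P *v y = l *\<^sub>R (D *v \<sigma>)"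
    using cert resid xstar by metis

  \<comment> \<open>The indices whose certificate entry can absorb a perturbation.\<close>
  define L where "L = J - {i. \<bar>\<sigma> $ i\<bar> = 1}"
  have "image_space ?P \<subseteq> image_space (cols D L)"
    unfolding L_def
  proof (rule image_Pi_tilde_outside_transition_space[OF assms(3) _ assms(8)])
    show "s \<in> sign_patterns (-J)"
      using u_J unfolding sign_patterns_def by (auto simp: s_nth sgn_if)
    show "l *\<^sub>R (?O *v s) - ?P *v y = l *\<^sub>R (cols D J *v \<sigma>)"
      using bal unfolding D_split by (simp add: algebra_simps)
  qed (use assms(2) in simp)
  then obtain R where "cols D L ** R = ?P"
    by (rule image_subset_imp_matrix_factor)
  then have R: "cols D L *v (R *v u) = ?P *v u" for u
    by (simp add: matrix_vector_mul_assoc)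

  \<comment> \<open>Dividing by the parameter makes the certificate equation affine in the shift \<open>\<delta>\<close>, and \<open>\<tau>\<close> is the corrected certificate: entries outside \<open>L\<close> are kept.\<close>
  define \<delta> where "\<delta> = (\<lambda>(yb, lb). inverse l *\<^sub>R y - inverse lb *\<^sub>R yb)"
  define \<tau> where "\<tau> = (\<lambda>p. \<sigma> + entries (R *v \<delta> p) L)"
  have good: "is_solution \<Phi> D yb lb (X (yb, lb))"
    if "lb > 0" and sg: "\<forall>i. i \<notin> J \<longrightarrow> s $ i * (transpose D *v X (yb, lb)) $ i > 0"
      and small: "\<forall>i. i \<in> L \<longrightarrow> \<bar>\<tau> (yb, lb) $ i\<bar> < 1" for yb lb
  proof -
    have "\<bar>\<tau> (yb, lb) $ i\<bar> \<le> 1" for i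
      using small \<sigma>_le[of i] by (cases "i \<in> L") (auto simp: \<tau>_def entries_def less_imp_le)
    moreover have "\<tau> (yb, lb) $ i * (transpose D *v X (yb, lb)) $ i
        = \<bar>(transpose D *v X (yb, lb)) $ i\<bar>" for i
    proof (cases "i \<in> J")
      case False
      then have "\<tau> (yb, lb) $ i = s $ i" by (simp add: \<tau>_def entries_def L_def \<sigma>_s)
      moreover have "s $ i = sgn ((transpose D *v X (yb, lb)) $ i)"
        using sg False s_nth[of i] by (auto simp: sgn_if zero_less_mult_iff split: if_splits)
      ultimately show ?thesis by (simp add: abs_sgn mult.commute)
    qed (simp add: X_J del: transpose_matrix_vector)
    ultimately have "\<tau> (yb, lb) \<in> l1_subgradients (transpose D *v X (yb, lb))"
      by (simp add: l1_subgradients_def)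
    moreover have "transpose \<Phi> *v (yb - \<Phi> *v X (yb, lb)) = lb *\<^sub>R (D *v \<tau> (yb, lb))"
    proof -
      have "?O *v s + cols D (-J) *v s = D *v \<sigma> + inverse l *\<^sub>R (?P *v y)"
      proof -
        have "l *\<^sub>R (?O *v s + cols D (-J) *v s) = l *\<^sub>R (D *v \<sigma> + inverse l *\<^sub>R (?P *v y))"
          using bal assms(2) by (simp add: algebra_simps)
        then show ?thesis using assms(2) by simp
      qed
      moreover have "D *v \<tau> (yb, lb) =
          D *v \<sigma> + inverse l *\<^sub>R (?P *v y) - inverse lb *\<^sub>R (?P *v yb)"
        using R[of "\<delta> (yb, lb)"] unfolding \<tau>_def cols_mult_vec
        by (simp add: \<delta>_def matrix_vector_right_distrib matrix_vector_mult_diff_distrib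
            matrix_vector_mult_scaleR)
      ultimately have "D *v \<tau> (yb, lb) =
          (?O *v s + cols D (-J) *v s) - inverse lb *\<^sub>R (?P *v yb)"
        by simp
      then show ?thesis
        unfolding resid using \<open>lb > 0\<close> by (simp add: scaleR_diff_right)
    qed
    ultimately show ?thesis
      using is_solution_iff_certificate[of lb \<Phi> D yb] \<open>lb > 0\<close> by auto
  qed

  have lim_mul: "((\<lambda>p. M *v f p) \<longlongrightarrow> M *v a) F" if "(f \<longlongrightarrow> a) F"
    for M :: "real^'b^'c" and f :: "(real^'q) \<times> real \<Rightarrow> real^'b" and a F
    using that by (rule bounded_linear.tendsto[OF matrix_vector_mul_bounded_linear])
  have limf: "(fst \<longlongrightarrow> y) (nhds (y, l))" and lims: "(snd \<longlongrightarrow> l) (nhds (y, l))"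
    using tendsto_fst[OF filterlim_ident[of "nhds (y,l)"]]
      tendsto_snd[OF filterlim_ident[of "nhds (y,l)"]] by simp_all
  have "(X \<longlongrightarrow> X (y, l)) (nhds (y, l))"
    unfolding X_def split_beta fst_conv snd_conv by (intro tendsto_intros lim_mul limf lims)
  then have limX: "((\<lambda>p. s $ i * (transpose D *v X p) $ i)
      \<longlongrightarrow> s $ i * (transpose D *v X (y, l)) $ i) (nhds (y, l))" for i
    by (intro tendsto_intros lim_mul)
  have "(\<delta> \<longlongrightarrow> \<delta> (y, l)) (nhds (y, l))"
    unfolding \<delta>_def split_beta fst_conv snd_conv
    by (intro tendsto_intros limf lims) (use assms(2) in simp)
  then have "((\<lambda>p. \<bar>\<sigma> $ i + (R *v \<delta> p) $ i\<bar>) \<longlongrightarrow> \<bar>\<sigma> $ i + (R *v \<delta> (y, l)) $ i\<bar>) (nhds (y, l))" for i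
    by (intro tendsto_intros lim_mul)
  moreover have "\<delta> (y, l) = 0" by (simp add: \<delta>_def)
  ultimately have lim\<tau>: "((\<lambda>p. \<bar>\<sigma> $ i + (R *v \<delta> p) $ i\<bar>) \<longlongrightarrow> \<bar>\<sigma> $ i\<bar>) (nhds (y, l))" for i
    by simp
  have "\<forall>\<^sub>F p in nhds (y, l). i \<notin> J \<longrightarrow> s $ i * (transpose D *v X p) $ i > 0" for i
  proof (cases "i \<in> J")
    case False
    then have "s $ i * (transpose D *v X (y, l)) $ i > 0"
      unfolding xstar[symmetric] s_nth using u_J[of i] by (simp add: sgn_if)
    then show ?thesis using order_tendstoD(1)[OF limX] by (auto elim: eventually_mono)
  qed simp
  then have ev1: "\<forall>\<^sub>F p in nhds (y, l). \<forall>i. i \<notin> J \<longrightarrow> s $ i * (transpose D *v X p) $ i > 0"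
    by (rule eventually_all_finite)
  have "\<forall>\<^sub>F p in nhds (y, l). i \<in> L \<longrightarrow> \<bar>\<tau> p $ i\<bar> < 1" for i
  proof (cases "i \<in> L")
    case True
    then have "\<bar>\<sigma> $ i\<bar> < 1" using \<sigma>_le[of i] by (auto simp: L_def)
    then show ?thesis
      using order_tendstoD(2)[OF lim\<tau>[of i], of 1] True by (simp add: \<tau>_def entries_def)
  qed simp
  then have ev2: "\<forall>\<^sub>F p in nhds (y, l). \<forall>i. i \<in> L \<longrightarrow> \<bar>\<tau> p $ i\<bar> < 1"
    by (rule eventually_all_finite)
  have ev3: "\<forall>\<^sub>F p in nhds (y, l). snd p > 0"
    using order_tendstoD(1)[OF lims assms(2)] .
  have "\<forall>\<^sub>F p in nhds (y, l). is_solution \<Phi> D (fst p) (snd p) (X p)"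
    using ev1 ev2 ev3 by eventually_elim (metis good prod.collapse)
  then obtain B where B: "open B" "(y, l) \<in> B" "\<forall>p\<in>B. is_solution \<Phi> D (fst p) (snd p) (X p)"
    unfolding eventually_nhds by blast
  show ?thesis
  proof (intro exI conjI)
    show "openin (top_of_set (UNIV \<times> {0..})) ((UNIV \<times> {0..}) \<inter> B)"
      using B(1) by (rule openin_open_Int)
    show "(y, l) \<in> (UNIV \<times> {0..}) \<inter> B"
      using B(2) assms(2) by simp
    show "\<forall>(yb, lb)\<in>(UNIV \<times> {0..}) \<inter> B. is_solution \<Phi> D yb lb (xhat lb yb)"
      using B(3) by (auto simp: xhat)
  qed
qed

end
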